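(* Let $\mathbb R^n_+=\{x\in\mathbb R^n: x_i>0\ \forall i\}$. Let $R$ be a vector field on $\mathbb R^n_+$, homogeneous of degree $0$, and let $W:\mathbb R^n_+\to\mathbb R$ be a positive differentiable function, homogeneous of degree $\alpha\ne0$. Suppose that $R(x)$ and $\rho(x)=W'(x)R(x)/\alpha$ are of class $C^1$. Then the solutions of $$\frac{dx}{dt}=R(x)$$ can be rescaled in space and positively reparametrized in time to solutions of the normalized flow $$\frac{dx}{dt}=R(x)-\rho(x)x,\qquad W(x)=1,$$ and vice versa. Furthermore, $R(x)=\lambda x$ for some $\lambda\in\mathbb R$ and $W(x)=1$ if and only if $x$ is an equilibrium of the normalized flow.
   Context: $W'(x)$ is the differential of $W$ at $x$. The normalized flow is the flow of $R(x)-\rho(x)x$ restricted to the level set $\{W=1\}$. "Rescaled in space and positively reparametrized in time" means: a solution $y(t)$ of one equation is multiplied by a positive scalar function $\lambda(t)$ and composed with an orientation-preserving change of the time variable. *)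

theory Defs
  imports "HOL-Analysis.Analysis"
begin

definition pos_orthant :: "(real ^ 'n) set" where
  "pos_orthant = {x. \<forall>i. 0 < x $ i}"

definition homogeneous_on :: "'a::real_vector set \<Rightarrow> real \<Rightarrow> ('a \<Rightarrow> 'b::real_vector) \<Rightarrow> bool" where
  "homogeneous_on S d f \<longleftrightarrow> (\<forall>x\<in>S. \<forall>c>0. f (c *\<^sub>R x) = (c powr d) *\<^sub>R f x)"

text \<open>The derivative is required to be continuous in the operator norm. The set \<open>S\<close> is meant
  to be open.\<close>
definition C1_on :: "'a::real_normed_vector set \<Rightarrow> ('a \<Rightarrow> 'b::real_normed_vector) \<Rightarrow> bool" where
  "C1_on S f \<longleftrightarrow>
     (\<exists>f' :: 'a \<Rightarrow> 'a \<Rightarrow>\<^sub>L 'b.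
        (\<forall>x\<in>S. (f has_derivative blinfun_apply (f' x)) (at x)) \<and> continuous_on S f')"

text \<open>Solutions live on arbitrary nondegenerate intervals (open or not, bounded or not, maximal
  or not); at an endpoint belonging to \<open>I\<close> the derivative is one-sided.\<close>
definition ode_solution ::
    "('a::real_normed_vector \<Rightarrow> 'a) \<Rightarrow> 'a set \<Rightarrow> (real \<Rightarrow> 'a) \<Rightarrow> real set \<Rightarrow> bool" where
  "ode_solution F S x I \<longleftrightarrow>
     is_interval I \<and> interior I \<noteq> {} \<and>
     (\<forall>t\<in>I. x t \<in> S \<and> (x has_vector_derivative F (x t)) (at t within I))"

definition equilibrium :: "('a::real_vector \<Rightarrow> 'a) \<Rightarrow> 'a set \<Rightarrow> 'a \<Rightarrow> bool" where
  "equilibrium F S x \<longleftrightarrow> x \<in> S \<and> F x = 0"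

text \<open>An orientation-preserving \<open>C\<^sup>1\<close> diffeomorphism from \<open>J\<close> onto \<open>I\<close>.\<close>
definition time_change :: "(real \<Rightarrow> real) \<Rightarrow> real set \<Rightarrow> real set \<Rightarrow> bool" where
  "time_change \<tau> J I \<longleftrightarrow>
     bij_betw \<tau> J I \<and>
     (\<exists>\<tau>'. continuous_on J \<tau>' \<and>
        (\<forall>s\<in>J. 0 < \<tau>' s \<and> (\<tau> has_real_derivative \<tau>' s) (at s within J)))"

definition rescales_to ::
    "(real \<Rightarrow> 'a::real_vector) \<Rightarrow> real set \<Rightarrow> (real \<Rightarrow> 'a) \<Rightarrow> real set \<Rightarrow> bool" where
  "rescales_to x I y J \<longleftrightarrow>
     (\<exists>\<mu> \<tau>. (\<forall>t\<in>I. 0 < (\<mu> t :: real)) \<and> time_change \<tau> J I \<and>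
        (\<forall>s\<in>J. y s = \<mu> (\<tau> s) *\<^sub>R x (\<tau> s)))"

definition rho ::
    "('a::real_normed_vector \<Rightarrow> real) \<Rightarrow> real \<Rightarrow> ('a \<Rightarrow> 'a) \<Rightarrow> 'a \<Rightarrow> real" where
  "rho W \<alpha> R x = frechet_derivative W (at x) (R x) / \<alpha>"

definition normalized_field ::
    "('a::real_normed_vector \<Rightarrow> real) \<Rightarrow> real \<Rightarrow> ('a \<Rightarrow> 'a) \<Rightarrow> 'a \<Rightarrow> 'a" where
  "normalized_field W \<alpha> R x = R x - rho W \<alpha> R x *\<^sub>R x"

definition level_one :: "(real ^ 'n \<Rightarrow> real) \<Rightarrow> (real ^ 'n) set" where
  "level_one W = {x \<in> pos_orthant. W x = 1}"

end

theory Submission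
  imports Defs
begin

text \<open>If \<open>x' = R(x)\<close> and \<open>m = W(x)\<^bsup>-1/\<alpha>\<^esup>\<close>, then \<open>m x\<close> lies on \<open>{W = 1}\<close> and, by homogeneity,
  \<open>(m x)' = m (R(m x) - \<rho>(m x) m x)\<close>. Conversely, if \<open>y\<close> solves the normalized equation and
  \<open>\<lambda>' = \<rho>(y) \<lambda>\<close> with \<open>\<lambda> > 0\<close>, then \<open>(\<lambda> y)' = \<lambda> R(\<lambda> y)\<close>. In both cases a change of time removes the
  positive factor in front of the vector field. The equilibria are identified by Euler's relation
  \<open>W'(x) x = \<alpha> W(x)\<close>.\<close>

section \<open>Changing time on arbitrary intervals\<close>

lemma is_interval_subset_real:
  fixes I :: "real set"
  assumes "is_interval I" "a \<in> I" "b \<in> I"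
  shows "{a..b} \<subseteq> I"
proof
  fix t assume "t \<in> {a..b}"
  then show "t \<in> I" using mem_is_interval_1_I[OF assms] by simp
qed

text \<open>The signed integral from a fixed base point \<open>a\<close> works. The fundamental
  theorem of calculus is applied on compact intervals, while \<open>I\<close> may be open, half-open
  or unbounded, so it is localized at each \<open>t\<close>; at an endpoint belonging to
  \<open>I\<close> this gives the one-sided derivative.\<close>

lemma ex_antiderivative_interval:
  fixes f :: "real \<Rightarrow> real"
  assumes I: "is_interval I" and f: "continuous_on I f"
  shows "\<exists>F. \<forall>t\<in>I. (F has_real_derivative f t) (at t within I)"
proof (cases "I = {}")
  case False
  then obtain a where a: "a \<in> I" by blast
  have "((\<lambda>u. LBINT y=a..u. f y) has_real_derivative f t) (at t within I)" if t: "t \<in> I" for t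
  proof -
    \<comment> \<open>A compact subinterval that contains \<open>a\<close> and is a neighbourhood of \<open>t\<close> in \<open>I\<close>.\<close>
    have "\<exists>d\<in>I. a \<le> d \<and> t \<le> d \<and> (t < d \<or> (\<forall>u\<in>I. u \<le> d))"
    proof (cases "\<exists>u\<in>I. max a t < u")
      case True
      then obtain u where "u \<in> I" "max a t < u" by blast
      then show ?thesis by (intro bexI[of _ u]) simp_all
    next
      case False
      then show ?thesis using a t by (intro bexI[of _ "max a t"]) (simp_all add: max_def not_less)
    qed
    then obtain d where d: "d \<in> I" "a \<le> d" "t \<le> d" "t < d \<or> (\<forall>u\<in>I. u \<le> d)" by blast
    have "\<exists>c\<in>I. c \<le> a \<and> c \<le> t \<and> (c < t \<or> (\<forall>u\<in>I. c \<le> u))"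
    proof (cases "\<exists>u\<in>I. u < min a t")
      case True
      then obtain u where "u \<in> I" "u < min a t" by blast
      then show ?thesis by (intro bexI[of _ u]) simp_all
    next
      case False
      then show ?thesis using a t by (intro bexI[of _ "min a t"]) (simp_all add: min_def not_less)
    qed
    then obtain c where c: "c \<in> I" "c \<le> a" "c \<le> t" "c < t \<or> (\<forall>u\<in>I. c \<le> u)" by blast
    have cd: "{c..d} \<subseteq> I" using is_interval_subset_real[OF I c(1) d(1)] .
    have "((\<lambda>u. LBINT y=a..u. f y) has_vector_derivative f t) (at t within {c..d})"
      using c d by (intro interval_integral_FTC2 continuous_on_subset[OF f cd]) simp_all
    moreover have "at t within I = at t within {c..d}"
    proof (rule at_within_nhd)
      \<comment> \<open>A cut is made only on a side where the compact interval extends beyond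
        \<open>t\<close>. On the other side \<open>t\<close> is an endpoint of \<open>I\<close>, so
        \<open>c\<close> or \<open>d\<close> already bounds all of \<open>I\<close>.\<close>
      let ?S = "(if c < t then {c<..} else UNIV) \<inter> (if t < d then {..<d} else UNIV)"
      show "t \<in> ?S" "open ?S" by (auto intro!: open_Int)
      have "u \<in> {c..d}" if "u \<in> I" "u \<in> ?S" for u
        using that c(4) d(4) by (cases "c < t"; cases "t < d") simp_all
      then show "I \<inter> ?S - {t} = {c..d} \<inter> ?S - {t}"
        using cd by blast
    qed
    ultimately show ?thesis by (simp add: has_real_derivative_iff_has_vector_derivative)
  qed
  then show ?thesis by blast
qed auto

text \<open>By the mean value theorem on \<open>{a..b}\<close>: the derivative within
  \<open>I\<close> is two-sided strictly between \<open>a\<close> and \<open>b\<close>, and at the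
  endpoints continuity suffices.\<close>

lemma has_real_derivative_pos_imp_strict_mono_on:
  fixes f :: "real \<Rightarrow> real"
  assumes I: "is_interval I"
    and f: "\<And>t. t \<in> I \<Longrightarrow> (f has_real_derivative f' t) (at t within I)"
    and pos: "\<And>t. t \<in> I \<Longrightarrow> 0 < f' t"
  shows "strict_mono_on I f"
proof (rule strict_mono_onI)
  fix a b assume ab: "a \<in> I" "b \<in> I" "a < b"
  have sub: "{a..b} \<subseteq> I" using is_interval_subset_real[OF I ab(1,2)] .
  show "f a < f b"
  proof (rule DERIV_pos_imp_increasing_open[OF ab(3)])
    fix t assume t: "a < t" "t < b"
    then have tI: "t \<in> I" using subsetD[OF sub, of t] by simp
    have "{a<..<b} \<subseteq> I" using sub by auto
    then have "(f has_real_derivative f' t) (at t within {a<..<b})"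
      by (rule DERIV_subset[OF f[OF tI]])
    then have "DERIV f t :> f' t" using t at_within_open[of t "{a<..<b}"] by simp
    with pos[OF tI] show "\<exists>y. DERIV f t :> y \<and> 0 < y" by blast
  next
    show "continuous_on {a..b} f"
      by (rule continuous_on_subset[OF DERIV_continuous_on[OF f] sub])
  qed
qed

lemma real_homeomorphism_of_strict_mono_on:
  fixes f :: "real \<Rightarrow> real"
  assumes "is_interval I" "continuous_on I f" "strict_mono_on I f"
  obtains g where "homeomorphism I (f ` I) f g"
  using homeomorphism_into_1d[OF is_interval_path_connected[OF assms(1)] assms(2) refl
      strict_mono_on_imp_inj_on[OF assms(3)]] that by blast

text \<open>Nondegeneracy of an interval in terms of order, a form that a strictly increasing map
  carries over to its image.\<close>

lemma interior_nonempty_iff_two_points: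
  fixes I :: "real set"
  assumes "is_interval I"
  shows "interior I \<noteq> {} \<longleftrightarrow> (\<exists>a\<in>I. \<exists>b\<in>I. a < b)"
proof
  assume "interior I \<noteq> {}"
  then obtain a e where "e > 0" "cball a e \<subseteq> I" by (auto simp: mem_interior_cball)
  moreover from \<open>e > 0\<close> have "a \<in> cball a e" "a + e \<in> cball a e" by (simp_all add: dist_real_def)
  ultimately have "a \<in> I" "a + e \<in> I" "a < a + e" by auto
  then show "\<exists>a\<in>I. \<exists>b\<in>I. a < b" by blast
next
  assume "\<exists>a\<in>I. \<exists>b\<in>I. a < b"
  then obtain a b where ab: "a \<in> I" "b \<in> I" "a < b" by blast
  then have "{a<..<b} \<subseteq> interior I"
    using is_interval_subset_real[OF assms ab(1,2)] by (intro interior_maximal) auto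
  then show "interior I \<noteq> {}" using ab(3) by auto
qed

text \<open>The new time is an antiderivative \<open>\<sigma>\<close> of \<open>g\<close>, strictly
  increasing since \<open>g\<close> is positive. Its inverse \<open>\<tau>\<close> has derivative
  \<open>1 / g\<close>, which cancels the factor \<open>g\<close> in the chain rule.\<close>

lemma ode_solution_time_change:
  fixes z :: "real \<Rightarrow> 'a::real_normed_vector"
  assumes I: "is_interval I" "interior I \<noteq> {}"
    and g: "continuous_on I g" "\<And>t. t \<in> I \<Longrightarrow> 0 < g t"
    and z: "\<And>t. t \<in> I \<Longrightarrow> z t \<in> S"
      "\<And>t. t \<in> I \<Longrightarrow> (z has_vector_derivative g t *\<^sub>R F (z t)) (at t within I)"
  obtains \<tau> J where "time_change \<tau> J I" "ode_solution F S (\<lambda>s. z (\<tau> s)) J"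
proof -
  obtain \<sigma> where \<sigma>: "\<And>t. t \<in> I \<Longrightarrow> (\<sigma> has_real_derivative g t) (at t within I)"
    using ex_antiderivative_interval[OF I(1) g(1)] by blast
  have mono: "strict_mono_on I \<sigma>"
    using has_real_derivative_pos_imp_strict_mono_on[OF I(1) \<sigma> g(2)] .
  define J where "J = \<sigma> ` I"
  have cont: "continuous_on I \<sigma>" by (rule DERIV_continuous_on[OF \<sigma>])
  then obtain \<tau> where hom: "homeomorphism I J \<sigma> \<tau>"
    using real_homeomorphism_of_strict_mono_on[OF I(1) _ mono] unfolding J_def by blast
  have \<tau>\<sigma>: "\<tau> (\<sigma> t) = t" if "t \<in> I" for t using hom that by (simp add: homeomorphism_def)
  have \<tau>I: "\<tau> s \<in> I" and \<sigma>\<tau>: "\<sigma> (\<tau> s) = s" if "s \<in> J" for s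
    using hom that homeomorphism_image2[OF hom] by (auto simp: homeomorphism_apply2)
  have \<tau>J: "\<tau> ` J = I" and contau: "continuous_on J \<tau>" using hom by (simp_all add: homeomorphism_def)
  have deriv: "(\<tau> has_real_derivative inverse (g (\<tau> s))) (at s within J)" if s: "s \<in> J" for s
  proof -
    let ?t = "\<tau> s"
    \<comment> \<open>The inverse function rule needs continuity of \<open>\<tau>\<close> on
      \<open>J\<close>, which the homeomorphism provides even at endpoints.\<close>
    have "(\<tau> has_derivative (*) (inverse (g ?t))) (at (\<sigma> ?t) within \<sigma> ` I)"
    proof (rule has_derivative_inverse_within)
      show "(\<sigma> has_derivative (*) (g ?t)) (at ?t within I)"
        using \<sigma>[OF \<tau>I[OF s]] by (simp add: has_field_derivative_def)
      show "continuous (at (\<sigma> ?t) within \<sigma> ` I) \<tau>"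
        unfolding \<sigma>\<tau>[OF s] J_def[symmetric]
        using contau s by (simp add: continuous_on_eq_continuous_within)
      show "(*) (inverse (g ?t)) \<circ> (*) (g ?t) = id"
        using g(2)[OF \<tau>I[OF s]] by (auto simp: fun_eq_iff)
      show "linear ((*) (inverse (g ?t)))" by (simp add: bounded_linear.linear bounded_linear_mult_right)
    qed (fact \<tau>I[OF s], fact \<tau>\<sigma>)
    then show ?thesis using \<sigma>\<tau>[OF s] by (simp add: has_field_derivative_def J_def)
  qed
  have "time_change \<tau> J I" unfolding time_change_def
  proof (intro conjI exI[of _ "\<lambda>s. inverse (g (\<tau> s))"] ballI)
    show "bij_betw \<tau> J I" using \<tau>J inj_on_inverseI[of J \<sigma> \<tau>] \<sigma>\<tau> by (simp add: bij_betw_def)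
    have "continuous_on J (\<lambda>s. g (\<tau> s))"
      by (rule continuous_on_compose2[OF g(1) contau]) (simp add: \<tau>J)
    moreover have "g (\<tau> s) \<noteq> 0" if "s \<in> J" for s using g(2)[OF \<tau>I[OF that]] by simp
    ultimately show "continuous_on J (\<lambda>s. inverse (g (\<tau> s)))"
      by (simp add: continuous_on_inverse)
    fix s assume s: "s \<in> J"
    show "0 < inverse (g (\<tau> s))" using g(2)[OF \<tau>I[OF s]] by simp
    show "(\<tau> has_real_derivative inverse (g (\<tau> s))) (at s within J)" by (rule deriv[OF s])
  qed
  moreover have "ode_solution F S (\<lambda>s. z (\<tau> s)) J" unfolding ode_solution_def
  proof (intro conjI ballI)
    show J: "is_interval J"
      using I(1) cont by (simp add: J_def is_interval_connected_1 connected_continuous_image)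
    obtain a b where "a \<in> I" "b \<in> I" "a < b"
      using I interior_nonempty_iff_two_points by blast
    then have "\<sigma> a \<in> J" "\<sigma> b \<in> J" "\<sigma> a < \<sigma> b"
      using strict_mono_onD[OF mono] by (simp_all add: J_def)
    then show "interior J \<noteq> {}" using interior_nonempty_iff_two_points[OF J] by blast
  next
    fix s assume s: "s \<in> J"
    have "((z \<circ> \<tau>) has_vector_derivative inverse (g (\<tau> s)) *\<^sub>R (g (\<tau> s) *\<^sub>R F (z (\<tau> s)))) (at s within J)"
      using deriv[OF s] z(2)[OF \<tau>I[OF s]] \<tau>J
      by (intro vector_diff_chain_within) (simp_all add: has_real_derivative_iff_has_vector_derivative)
    then show "((\<lambda>s. z (\<tau> s)) has_vector_derivative F (z (\<tau> s))) (at s within J)"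
      using g(2)[OF \<tau>I[OF s]] by (simp add: o_def)
    show "z (\<tau> s) \<in> S" by (rule z(1)[OF \<tau>I[OF s]])
  qed
  ultimately show thesis by (rule that)
qed

lemma rescales_to_time_change:
  assumes "\<And>t. t \<in> I \<Longrightarrow> 0 < (\<mu> t :: real)" "time_change \<tau> J I"
  shows "rescales_to x I (\<lambda>s. \<mu> (\<tau> s) *\<^sub>R x (\<tau> s)) J"
  unfolding rescales_to_def using assms by blast

section \<open>Homogeneous functions on the positive orthant\<close>

lemma open_pos_orthant: "open (pos_orthant :: (real ^ 'n) set)"
proof -
  have "pos_orthant = (\<Inter>i. {x :: real ^ 'n. 0 < x $ i})" by (auto simp: pos_orthant_def)
  also have "open \<dots>" by (intro open_INT) (auto intro!: open_Collect_less continuous_intros)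
  finally show ?thesis .
qed

lemma scaleR_pos_orthant: "x \<in> pos_orthant \<Longrightarrow> 0 < c \<Longrightarrow> c *\<^sub>R x \<in> pos_orthant"
  by (simp add: pos_orthant_def)

lemma C1_on_imp_continuous_on: "C1_on S f \<Longrightarrow> continuous_on S f"
  unfolding C1_on_def
  by (blast intro: continuous_at_imp_continuous_on has_derivative_continuous)

locale normalizable_flow =
  fixes R :: "real ^ 'n \<Rightarrow> real ^ 'n" and W :: "real ^ 'n \<Rightarrow> real" and \<alpha> :: real
  assumes R_homogeneous: "homogeneous_on pos_orthant 0 R"
    and W_pos: "x \<in> pos_orthant \<Longrightarrow> 0 < W x"
    and W_differentiable: "W differentiable_on pos_orthant"
    and alpha_nonzero: "\<alpha> \<noteq> 0"
    and W_homogeneous: "homogeneous_on pos_orthant \<alpha> W"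
    and rho_continuous: "continuous_on pos_orthant (rho W \<alpha> R)"
begin

abbreviation DW :: "real ^ 'n \<Rightarrow> real ^ 'n \<Rightarrow> real" where
  "DW x \<equiv> frechet_derivative W (at x)"

lemma DW: "x \<in> pos_orthant \<Longrightarrow> (W has_derivative DW x) (at x)"
  using W_differentiable differentiable_on_eq_differentiable_at[OF open_pos_orthant]
    frechet_derivative_works by blast

lemma DW_eq_rho: "DW x (R x) = \<alpha> * rho W \<alpha> R x"
  using alpha_nonzero by (simp add: rho_def)

lemma W_scaleR: "x \<in> pos_orthant \<Longrightarrow> 0 < c \<Longrightarrow> W (c *\<^sub>R x) = c powr \<alpha> * W x"
  using W_homogeneous by (simp add: homogeneous_on_def)

lemma R_scaleR: "x \<in> pos_orthant \<Longrightarrow> 0 < c \<Longrightarrow> R (c *\<^sub>R x) = R x"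
  using R_homogeneous by (simp add: homogeneous_on_def)

text \<open>Both sides of \<open>W (c *\<^sub>R x) = c powr \<alpha> * W x\<close> are
  differentiated in \<open>c\<close> at \<open>c = 1\<close>; the identity holds for positive
  \<open>c\<close>, an open neighbourhood of 1.\<close>

lemma euler_relation:
  assumes x: "x \<in> pos_orthant"
  shows "DW x x = \<alpha> * W x"
proof -
  have "((\<lambda>c. W (c *\<^sub>R x)) has_derivative (\<lambda>h. DW x (h *\<^sub>R x))) (at 1)"
    by (rule has_derivative_compose[where f = "\<lambda>c. c *\<^sub>R x"])
      (use DW[OF x] in \<open>auto intro!: derivative_eq_intros\<close>)
  moreover have "((\<lambda>c. c powr \<alpha> * W x) has_derivative (\<lambda>h. h * (\<alpha> * W x))) (at 1)"
    by (auto intro!: derivative_eq_intros simp: mult_ac)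
  then have "((\<lambda>c. W (c *\<^sub>R x)) has_derivative (\<lambda>h. h * (\<alpha> * W x))) (at 1)"
    by (rule has_derivative_transform_within_open[where s = "{0<..}"]) (auto simp: W_scaleR x)
  ultimately have "(\<lambda>h. DW x (h *\<^sub>R x)) = (\<lambda>h. h * (\<alpha> * W x))" by (rule has_derivative_unique)
  from fun_cong[OF this, of 1] show ?thesis by simp
qed

text \<open>The same identity, now differentiated in \<open>x\<close> with \<open>c\<close> fixed:
  \<open>DW\<close> is homogeneous of degree \<alpha> - 1. The factor \<open>c\<close> stays on the
  left to avoid that exponent.\<close>

lemma DW_scaleR:
  assumes x: "x \<in> pos_orthant" and c: "0 < c"
  shows "c * DW (c *\<^sub>R x) v = c powr \<alpha> * DW x v"
proof -
  have lin: "linear (DW (c *\<^sub>R x))"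
    using DW[OF scaleR_pos_orthant[OF x c]] has_derivative_linear by blast
  have "((\<lambda>x. W (c *\<^sub>R x)) has_derivative (\<lambda>h. DW (c *\<^sub>R x) (c *\<^sub>R h))) (at x)"
    by (rule has_derivative_compose[where f = "\<lambda>x. c *\<^sub>R x"])
      (use DW[OF scaleR_pos_orthant[OF x c]] in \<open>auto intro!: derivative_eq_intros\<close>)
  moreover have "((\<lambda>x. c powr \<alpha> * W x) has_derivative (\<lambda>h. c powr \<alpha> * DW x h)) (at x)"
    by (intro has_derivative_mult_right DW x)
  then have "((\<lambda>x. W (c *\<^sub>R x)) has_derivative (\<lambda>h. c powr \<alpha> * DW x h)) (at x)"
    by (rule has_derivative_transform_within_open[OF _ open_pos_orthant x]) (simp add: W_scaleR c)
  ultimately have "(\<lambda>h. DW (c *\<^sub>R x) (c *\<^sub>R h)) = (\<lambda>h. c powr \<alpha> * DW x h)"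
    by (rule has_derivative_unique)
  from fun_cong[OF this, of v] show ?thesis by (simp add: linear_cmul[OF lin])
qed

text \<open>Since \<open>R\<close> does not change under scaling, \<open>rho\<close> inherits the
  degree \<alpha> - 1 of \<open>DW\<close>.\<close>

lemma rho_scaleR:
  assumes x: "x \<in> pos_orthant" and c: "0 < c"
  shows "c * rho W \<alpha> R (c *\<^sub>R x) = c powr \<alpha> * rho W \<alpha> R x"
  using DW_scaleR[OF x c, of "R x"] by (simp add: rho_def R_scaleR[OF x c])

section \<open>Rescaling solutions in both directions, and the equilibria\<close>

lemma normalized_solution_of_solution:
  assumes "ode_solution R pos_orthant x I"
  shows "\<exists>y J. ode_solution (normalized_field W \<alpha> R) (level_one W) y J \<and> rescales_to x I y J"
proof -
  have I: "is_interval I" "interior I \<noteq> {}"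
    and xS: "\<And>t. t \<in> I \<Longrightarrow> x t \<in> pos_orthant"
    and x': "\<And>t. t \<in> I \<Longrightarrow> (x has_vector_derivative R (x t)) (at t within I)"
    using assms by (auto simp: ode_solution_def)
  \<comment> \<open>The exponent is forced by the level set: \<open>W (m t *\<^sub>R x t)\<close>
    equals \<open>m t powr \<alpha> * W (x t)\<close>, which has to be 1.\<close>
  define m where "m t = W (x t) powr (- 1 / \<alpha>)" for t
  have m_pos: "0 < m t" if "t \<in> I" for t using W_pos[OF xS[OF that]] by (simp add: m_def)
  have m_powr: "m t powr \<alpha> = 1 / W (x t)" if "t \<in> I" for t
    unfolding m_def powr_powr using W_pos[OF xS[OF that]] alpha_nonzero
    by (simp add: powr_minus_divide)
  \<comment> \<open>With \<open>rho\<close> evaluated at the rescaled point, the product rule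
    directly yields \<open>m t\<close> times the normalized field there.\<close>
  have m': "(m has_real_derivative - (m t)\<^sup>2 * rho W \<alpha> R (m t *\<^sub>R x t)) (at t within I)"
    if t: "t \<in> I" for t
  proof -
    have lin: "linear (DW (x t))" using DW[OF xS[OF t]] has_derivative_linear by blast
    have "((\<lambda>t. W (x t)) has_derivative (\<lambda>h. DW (x t) (h *\<^sub>R R (x t)))) (at t within I)"
      using x'[OF t] DW[OF xS[OF t]] unfolding has_vector_derivative_def
      by (rule has_derivative_compose)
    moreover have "(\<lambda>h. DW (x t) (h *\<^sub>R R (x t))) = (*) (\<alpha> * rho W \<alpha> R (x t))"
      by (simp add: fun_eq_iff linear_cmul[OF lin] DW_eq_rho)
    ultimately have W': "((\<lambda>t. W (x t)) has_real_derivative \<alpha> * rho W \<alpha> R (x t)) (at t within I)"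
      by (simp add: has_field_derivative_def)
    have "(m has_real_derivative
        (- 1 / \<alpha>) * W (x t) powr (- 1 / \<alpha> - 1) * (\<alpha> * rho W \<alpha> R (x t))) (at t within I)"
      unfolding m_def[abs_def]
      by (rule DERIV_chain2[OF has_real_derivative_powr[OF W_pos[OF xS[OF t]]] W'])
    moreover have "(- 1 / \<alpha>) * W (x t) powr (- 1 / \<alpha> - 1) * (\<alpha> * rho W \<alpha> R (x t))
        = - (m t)\<^sup>2 * rho W \<alpha> R (m t *\<^sub>R x t)"
    proof -
      \<comment> \<open>One factor \<open>m t\<close> is spent on the scaling law of
        \<open>rho\<close>; the resulting power \<open>m t powr \<alpha>\<close> is
        \<open>1 / W (x t)\<close>, which lowers the exponent of the other factor by 1.\<close>
      have "(m t)\<^sup>2 * rho W \<alpha> R (m t *\<^sub>R x t) = m t * (m t powr \<alpha> * rho W \<alpha> R (x t))"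
        using rho_scaleR[OF xS[OF t] m_pos[OF t]] by (simp add: power2_eq_square)
      also have "\<dots> = W (x t) powr (- 1 / \<alpha> - 1) * rho W \<alpha> R (x t)"
        unfolding m_powr[OF t] using W_pos[OF xS[OF t]] by (simp add: powr_diff m_def)
      finally show ?thesis using alpha_nonzero by simp
    qed
    ultimately show ?thesis by simp
  qed
  have zS: "m t *\<^sub>R x t \<in> level_one W" if "t \<in> I" for t
    using scaleR_pos_orthant[OF xS[OF that] m_pos[OF that]] W_scaleR[OF xS[OF that] m_pos[OF that]]
      m_powr[OF that] W_pos[OF xS[OF that]] by (simp add: level_one_def)
  have z': "((\<lambda>t. m t *\<^sub>R x t) has_vector_derivative
      m t *\<^sub>R normalized_field W \<alpha> R (m t *\<^sub>R x t)) (at t within I)" if t: "t \<in> I" for t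
    using has_vector_derivative_scaleR[OF m'[OF t] x'[OF t]] R_scaleR[OF xS[OF t] m_pos[OF t]]
    by (simp add: normalized_field_def algebra_simps power2_eq_square)
  have "continuous_on I m" by (rule DERIV_continuous_on[OF m'])
  \<comment> \<open>Here \<open>m\<close> plays two roles: it is the spatial factor and also the
    speed \<open>g\<close> removed by the time change.\<close>
  from ode_solution_time_change[OF I this m_pos zS z'] obtain \<tau> J
    where \<tau>: "time_change \<tau> J I"
      and y: "ode_solution (normalized_field W \<alpha> R) (level_one W) (\<lambda>s. m (\<tau> s) *\<^sub>R x (\<tau> s)) J" .
  have "rescales_to x I (\<lambda>s. m (\<tau> s) *\<^sub>R x (\<tau> s)) J"
    using m_pos \<tau> by (rule rescales_to_time_change)
  with y show ?thesis by blast
qed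

lemma solution_of_normalized_solution:
  assumes "ode_solution (normalized_field W \<alpha> R) (level_one W) y J"
  shows "\<exists>x I. ode_solution R pos_orthant x I \<and> rescales_to y J x I"
proof -
  have J: "is_interval J" "interior J \<noteq> {}"
    and yS: "\<And>s. s \<in> J \<Longrightarrow> y s \<in> pos_orthant"
    and y': "\<And>s. s \<in> J \<Longrightarrow>
      (y has_vector_derivative R (y s) - rho W \<alpha> R (y s) *\<^sub>R y s) (at s within J)"
    using assms by (auto simp: ode_solution_def level_one_def normalized_field_def)
  have "continuous_on J y"
    using y' has_vector_derivative_continuous by (blast intro: continuous_on_eq_continuous_within[THEN iffD2])
  then have "continuous_on J (\<lambda>s. rho W \<alpha> R (y s))"
    by (rule continuous_on_compose2[OF rho_continuous]) (use yS in auto)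
  then obtain P where P: "\<And>s. s \<in> J \<Longrightarrow> (P has_real_derivative rho W \<alpha> R (y s)) (at s within J)"
    using ex_antiderivative_interval[OF J(1)] by blast
  \<comment> \<open>This is a positive solution of the linear equation \<open>l' = rho(y) l\<close>.
    In the derivative of \<open>l y\<close> the term \<open>l' y\<close> cancels the normalizing
    term, leaving \<open>l R(y) = l R(l y)\<close>. As before, \<open>l\<close> is both spatial
    factor and speed.\<close>
  define l where "l s = exp (P s)" for s
  have l_pos: "0 < l s" for s by (simp add: l_def)
  have l': "(l has_real_derivative l s * rho W \<alpha> R (y s)) (at s within J)" if "s \<in> J" for s
    unfolding l_def[abs_def] using P[OF that] by (auto intro!: derivative_eq_intros)
  have z': "((\<lambda>s. l s *\<^sub>R y s) has_vector_derivative l s *\<^sub>R R (l s *\<^sub>R y s)) (at s within J)"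
    if s: "s \<in> J" for s
    using has_vector_derivative_scaleR[OF l'[OF s] y'[OF s]]
    by (simp add: R_scaleR[OF yS[OF s] l_pos] algebra_simps)
  have "continuous_on J l" by (rule DERIV_continuous_on[OF l'])
  from ode_solution_time_change[OF J this l_pos scaleR_pos_orthant[OF yS l_pos] z'] obtain \<tau> I
    where \<tau>: "time_change \<tau> I J"
      and x: "ode_solution R pos_orthant (\<lambda>s. l (\<tau> s) *\<^sub>R y (\<tau> s)) I" .
  have "rescales_to y J (\<lambda>s. l (\<tau> s) *\<^sub>R y (\<tau> s)) I"
    using l_pos \<tau> by (rule rescales_to_time_change)
  with x show ?thesis by blast
qed

text \<open>If \<open>R x = l *\<^sub>R x\<close> and \<open>W x = 1\<close>, linearity of
  \<open>DW x\<close> and Euler's relation give \<open>rho W \<alpha> R x = l\<close>, so the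
  normalized field vanishes at \<open>x\<close>.\<close>

lemma equilibrium_iff:
  assumes x: "x \<in> pos_orthant"
  shows "(\<exists>l. R x = l *\<^sub>R x) \<and> W x = 1 \<longleftrightarrow> equilibrium (normalized_field W \<alpha> R) (level_one W) x"
proof
  assume "(\<exists>l. R x = l *\<^sub>R x) \<and> W x = 1"
  then obtain l where l: "R x = l *\<^sub>R x" and "W x = 1" by blast
  moreover have "linear (DW x)" using DW[OF x] has_derivative_linear by blast
  then have "rho W \<alpha> R x = l * W x"
    using euler_relation[OF x] alpha_nonzero by (simp add: rho_def l linear_cmul)
  ultimately show "equilibrium (normalized_field W \<alpha> R) (level_one W) x"
    using x by (simp add: equilibrium_def level_one_def normalized_field_def)
\<comment> \<open>Conversely, at an equilibrium the multiplier \<open>l\<close> is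
  \<open>rho W \<alpha> R x\<close>.\<close>
qed (auto simp: equilibrium_def level_one_def normalized_field_def)

end

theorem theorem4p1:
  fixes R :: "real ^ 'n \<Rightarrow> real ^ 'n"
    and W :: "real ^ 'n \<Rightarrow> real"
    and \<alpha> :: real
  assumes "homogeneous_on pos_orthant 0 R"
    and "\<forall>x\<in>pos_orthant. 0 < W x"
    and "W differentiable_on pos_orthant"
    and "\<alpha> \<noteq> 0"
    and "homogeneous_on pos_orthant \<alpha> W"
    and "C1_on pos_orthant R"
    and "C1_on pos_orthant (rho W \<alpha> R)"
  shows "(\<forall>x I. ode_solution R pos_orthant x I \<longrightarrow>
           (\<exists>y J. ode_solution (normalized_field W \<alpha> R) (level_one W) y J \<and> rescales_to x I y J)) \<and>
         (\<forall>y J. ode_solution (normalized_field W \<alpha> R) (level_one W) y J \<longrightarrow>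
           (\<exists>x I. ode_solution R pos_orthant x I \<and> rescales_to y J x I)) \<and>
         (\<forall>x\<in>pos_orthant. (\<exists>l. R x = l *\<^sub>R x) \<and> W x = 1 \<longleftrightarrow>
           equilibrium (normalized_field W \<alpha> R) (level_one W) x)"
proof -
  interpret normalizable_flow R W \<alpha>
    by standard (use assms C1_on_imp_continuous_on in auto)
  show ?thesis
    using normalized_solution_of_solution solution_of_normalized_solution equilibrium_iff by blast
qed

end
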